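(* Let $X=\mathbb{N}\times\mathbb{N}$ be the two-dimensional Chebyshev hypergroup. A function $M:\mathbb{N}\times\mathbb{N}\to\mathbb{C}$ is an exponential on $X$ if and only if there exist complex numbers $\lambda,\mu$ such that $$M(x,y)=T_x(\lambda)\,T_y(\mu)$$ holds for all $(x,y)\in X$. The correspondence between the exponentials $M$ on $X$ and the pairs $(\lambda,\mu)\in\mathbb{C}^2$ is one-to-one.
   Context: $\mathbb{N}=\{0,1,2,\dots\}$. $T_n$ denotes the $n$-th Chebyshev polynomial of the first kind: $T_0(z)=1$, $T_1(z)=z$, and $zT_n(z)=\frac12[T_{n-1}(z)+T_{n+1}(z)]$ for $n\ge1$. The two-dimensional Chebyshev hypergroup is the discrete commutative hypergroup on $X=\mathbb{N}\times\mathbb{N}$ whose convolution of point masses is $$\delta_{k,l}*\delta_{m,n}=\tfrac14\big[\delta_{|k-m|,|l-n|}+\delta_{|k-m|,l+n}+\delta_{k+m,|l-n|}+\delta_{k+m,l+n}\big]$$ for all $k,l,m,n\in\mathbb{N}$, whose involution is the identity mapping and whose identity element is $(0,0)$. For $h:X\to\mathbb{C}$ and $p,q\in X$ write $h(p*q)=\int_X h\,d(\delta_p*\delta_q)$. An exponential on $X$ is a not identically zero function $M:X\to\mathbb{C}$ with $M(p*q)=M(p)M(q)$ for all $p,q\in X$. *)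

theory Defs
  imports
    "HOL-Computational_Algebra.Polynomial"
    "HOL-Probability.Probability_Mass_Function"
begin

fun chebyshev :: "nat \<Rightarrow> complex poly" where
  "chebyshev 0 = 1"
| "chebyshev (Suc 0) = [:0, 1:]"
| "chebyshev (Suc (Suc n)) = 2 * [:0, 1:] * chebyshev (Suc n) - chebyshev n"

lemma chebyshev_recurrence:
  assumes "n \<ge> 1"
  shows "z * poly (chebyshev n) z
           = 1 / 2 * (poly (chebyshev (n - 1)) z + poly (chebyshev (n + 1)) z)"
  using assms by (cases n) auto

text \<open>
  On a discrete space the convolution of two point masses is a probability measure with finite
  support, so the convolution of a discrete hypergroup is given by a function
  \<open>'a \<Rightarrow> 'a \<Rightarrow> 'a pmf\<close> sending \<open>p\<close>, \<open>q\<close> to \<open>\<delta>\<^sub>p * \<delta>\<^sub>q\<close>.  The involution and the identity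
  element do not occur in the definition of an exponential.  Finiteness of the supports makes
  every function integrable, so the totalised integral never takes its default value.
\<close>

definition hyper_eval :: "('a \<Rightarrow> 'a \<Rightarrow> 'a pmf) \<Rightarrow> ('a \<Rightarrow> complex) \<Rightarrow> 'a \<Rightarrow> 'a \<Rightarrow> complex" where
  "hyper_eval conv h p q = measure_pmf.expectation (conv p q) h"

definition exponential :: "('a \<Rightarrow> 'a \<Rightarrow> 'a pmf) \<Rightarrow> ('a \<Rightarrow> complex) \<Rightarrow> bool" where
  "exponential conv M \<longleftrightarrow>
     (\<exists>p. M p \<noteq> 0) \<and> (\<forall>p q. hyper_eval conv M p q = M p * M q)"

definition nat_dist :: "nat \<Rightarrow> nat \<Rightarrow> nat" where
  "nat_dist k m = nat \<bar>int k - int m\<bar>"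

text \<open>
  \<open>pmf_of_multiset\<close> counts multiplicities, so coinciding points (for instance when \<open>k = 0\<close>)
  have their weights 1/4 added, as in a sum of four point masses;
  see \<open>pmf_chebyshev_conv\<close> below.
\<close>

definition chebyshev_conv :: "nat \<times> nat \<Rightarrow> nat \<times> nat \<Rightarrow> (nat \<times> nat) pmf" where
  "chebyshev_conv = (\<lambda>(k, l) (m, n). pmf_of_multiset
     {# (nat_dist k m, nat_dist l n), (nat_dist k m, l + n),
        (k + m, nat_dist l n), (k + m, l + n) #})"

lemma pmf_chebyshev_conv:
  "pmf (chebyshev_conv (k, l) (m, n)) r =
     1 / 4 * (indicator {(nat_dist k m, nat_dist l n)} r + indicator {(nat_dist k m, l + n)} r
            + indicator {(k + m, nat_dist l n)} r + indicator {(k + m, l + n)} r)"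
  unfolding chebyshev_conv_def by (simp add: indicator_def add_divide_distrib)

end

theory Submission
  imports Defs
begin

text \<open>
  Convolution with \<open>(0, n)\<close> acts only on the second coordinate and convolution with \<open>(k, 0)\<close> only
  on the first, and the convolution of \<open>(x, 0)\<close> and \<open>(0, y)\<close> is the single point mass at
  \<open>(x, y)\<close>.  An exponential \<open>M\<close> therefore splits as \<open>M (x, 0) * M (0, y)\<close>, and multiplying by the
  generators \<open>(1, 0)\<close> and \<open>(0, 1)\<close> turns multiplicativity into the Chebyshev recurrence for each
  factor.  Together with the value 1 at the identity element \<open>(0, 0)\<close>, this recurrence determines
  the factors from \<open>M (1, 0)\<close> and \<open>M (0, 1)\<close>, which are thus the parameters \<open>\<lambda>\<close> and \<open>\<mu>\<close>; reading
  them off as these two values also shows that they are unique.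

  Conversely, the product formula \<open>2 T\<^sub>k T\<^sub>m = T\<^bsub>k+m\<^esub> + T\<^bsub>|k-m|\<^esub>\<close> (\<open>chebyshev_product\<close>) holds in each
  coordinate, and the product of two such identities is exactly the four-term average defining
  the two-dimensional convolution.
\<close>

lemma nat_dist_commute: "nat_dist k m = nat_dist m k"
  by (simp add: nat_dist_def abs_minus_commute)

lemma nat_dist_0 [simp]: "nat_dist 0 n = n" "nat_dist n 0 = n"
  by (simp_all add: nat_dist_def)

lemma nat_dist_eq_diff: "m \<le> k \<Longrightarrow> nat_dist k m = k - m"
  by (simp add: nat_dist_def)

lemma hyper_eval_chebyshev_conv:
  "hyper_eval chebyshev_conv h (k, l) (m, n) =
     1 / 4 * (h (nat_dist k m, nat_dist l n) + h (nat_dist k m, l + n)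
            + h (k + m, nat_dist l n) + h (k + m, l + n))"
proof -
  let ?A = "{(nat_dist k m, nat_dist l n), (nat_dist k m, l + n),
             (k + m, nat_dist l n), (k + m, l + n)}"
  have support: "set_pmf (chebyshev_conv (k, l) (m, n)) \<subseteq> ?A"
    by (auto simp: chebyshev_conv_def)
  have "hyper_eval chebyshev_conv h (k, l) (m, n) =
          (\<Sum>r\<in>?A. pmf (chebyshev_conv (k, l) (m, n)) r *\<^sub>R h r)"
    unfolding hyper_eval_def
    by (rule integral_measure_pmf) (use support in auto)
  \<comment> \<open>Splitting the mass into the four indicators before summing avoids a case analysis on which
    of the four points coincide.\<close>
  also have "\<dots> = 1 / 4 *
      ((\<Sum>r\<in>?A. indicator {(nat_dist k m, nat_dist l n)} r * h r)
       + (\<Sum>r\<in>?A. indicator {(nat_dist k m, l + n)} r * h r)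
       + (\<Sum>r\<in>?A. indicator {(k + m, nat_dist l n)} r * h r)
       + (\<Sum>r\<in>?A. indicator {(k + m, l + n)} r * h r))"
    unfolding sum.distrib [symmetric] sum_distrib_left
    by (intro sum.cong refl)
       (simp add: pmf_chebyshev_conv scaleR_conv_of_real indicator_def algebra_simps)
  also have "\<dots> = 1 / 4 * (h (nat_dist k m, nat_dist l n) + h (nat_dist k m, l + n)
            + h (k + m, nat_dist l n) + h (k + m, l + n))"
  proof -
    have pick: "(\<Sum>r\<in>?A. indicator {p} r * h r) = h p" if "p \<in> ?A" for p
    proof -
      have "(\<Sum>r\<in>?A. indicator {p} r * h r) = (\<Sum>r\<in>?A. if p = r then h r else 0)"
        by (intro sum.cong) (auto simp: indicator_def)
      also have "\<dots> = h p"
        using that by (subst sum.delta') auto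
      finally show ?thesis .
    qed
    show ?thesis
      by (subst (1 2 3 4) pick) auto
  qed
  finally show ?thesis .
qed

lemma chebyshev_product_le:
  assumes "n \<le> m"
  shows "2 * poly (chebyshev m) z * poly (chebyshev n) z =
           poly (chebyshev (m + n)) z + poly (chebyshev (m - n)) z"
  using assms
proof (induction n rule: chebyshev.induct)
  case 1
  show ?case by simp
next
  case 2
  then obtain j where "m = Suc j"
    by (cases m) auto
  then show ?case by simp
next
  case (3 n)
  then obtain j where m: "m = Suc (Suc (n + j))"
    by (metis add_Suc le_iff_add)
  have down: "poly (chebyshev (Suc (Suc j))) z =
                2 * z * poly (chebyshev (Suc j)) z - poly (chebyshev j) z"
    and up: "poly (chebyshev (Suc (Suc (m + n)))) z =
                2 * z * poly (chebyshev (Suc (m + n))) z - poly (chebyshev (m + n)) z"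
    by simp_all
  have IH0: "2 * poly (chebyshev m) z * poly (chebyshev n) z =
               poly (chebyshev (m + n)) z + poly (chebyshev (Suc (Suc j))) z"
    using "3.IH"(2) m by (simp del: chebyshev.simps)
  have IH1: "2 * poly (chebyshev m) z * poly (chebyshev (Suc n)) z =
               poly (chebyshev (Suc (m + n))) z + poly (chebyshev (Suc j)) z"
    using "3.IH"(1) m by (simp del: chebyshev.simps)
  have "2 * poly (chebyshev m) z * poly (chebyshev (Suc (Suc n))) z =
          2 * z * (2 * poly (chebyshev m) z * poly (chebyshev (Suc n)) z)
          - 2 * poly (chebyshev m) z * poly (chebyshev n) z"
    by (simp add: algebra_simps)
  also have "\<dots> = poly (chebyshev (Suc (Suc (m + n)))) z + poly (chebyshev j) z"
    unfolding IH0 IH1 up down by (simp add: algebra_simps del: chebyshev.simps)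
  finally show ?case
    using m by (simp del: chebyshev.simps)
qed

text \<open>
  With \<open>z = cos t\<close> this is the addition formula
  \<open>2 cos (k t) cos (m t) = cos ((k + m) t) + cos ((k - m) t)\<close>.
\<close>

lemma chebyshev_product:
  "2 * poly (chebyshev k) z * poly (chebyshev m) z =
     poly (chebyshev (k + m)) z + poly (chebyshev (nat_dist k m)) z"
proof (cases "m \<le> k")
  case True
  then show ?thesis
    by (simp add: chebyshev_product_le nat_dist_eq_diff)
next
  case False
  then show ?thesis
    using chebyshev_product_le [of k m z]
    by (simp add: nat_dist_commute [of k m] nat_dist_eq_diff ac_simps)
qed

text \<open>
  The recurrence is the case \<open>m = 1\<close> of the product formula, so \<open>f\<close> need only be multiplicative
  against the generator 1 of the one-dimensional hypergroup.
\<close>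

lemma chebyshev_unique:
  assumes "f 0 = 1" and "\<And>n. f (Suc (Suc n)) + f n = 2 * f (Suc n) * f (Suc 0)"
  shows "f n = poly (chebyshev n) (f (Suc 0))"
proof (induction n rule: chebyshev.induct)
  case (3 n)
  have "f (Suc (Suc n)) = 2 * f (Suc n) * f (Suc 0) - f n"
    by (simp add: assms(2) [of n, symmetric])
  then show ?case
    using 3 by simp
qed (simp_all add: assms(1))

lemma exponential_chebyshev_product:
  assumes "\<And>x y. M (x, y) = poly (chebyshev x) lam * poly (chebyshev y) mu"
  shows "exponential chebyshev_conv M"
  unfolding exponential_def
proof (intro conjI allI)
  show "\<exists>p. M p \<noteq> 0"
    using assms [of 0 0] by (intro exI [of _ "(0, 0)"]) simp
next
  fix p q :: "nat \<times> nat"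
  obtain k l m n where pq: "p = (k, l)" "q = (m, n)"
    by (metis surj_pair)
  have "hyper_eval chebyshev_conv M p q =
          1 / 4 * ((poly (chebyshev (k + m)) lam + poly (chebyshev (nat_dist k m)) lam)
                 * (poly (chebyshev (l + n)) mu + poly (chebyshev (nat_dist l n)) mu))"
    unfolding pq hyper_eval_chebyshev_conv assms by (simp add: algebra_simps)
  also have "\<dots> = M p * M q"
    unfolding chebyshev_product [symmetric] pq assms by simp
  finally show "hyper_eval chebyshev_conv M p q = M p * M q" .
qed

text \<open>
  Each coordinate axis is closed under convolution, so \<open>M\<close> restricted to an axis obeys the
  recurrence of \<open>chebyshev_unique\<close>.  Giving the parameters as values of \<open>M\<close> at the two
  generators makes the inverse of the correspondence explicit.
\<close>

lemma exponential_imp_chebyshev_product: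
  assumes "exponential chebyshev_conv M"
  shows "M (x, y) = poly (chebyshev x) (M (Suc 0, 0)) * poly (chebyshev y) (M (0, Suc 0))"
proof -
  have mult: "M (k, l) * M (m, n) =
      1 / 4 * (M (nat_dist k m, nat_dist l n) + M (nat_dist k m, l + n)
             + M (k + m, nat_dist l n) + M (k + m, l + n))" for k l m n
    using assms by (metis exponential_def hyper_eval_chebyshev_conv)
  obtain a b where "M (a, b) \<noteq> 0"
    using assms unfolding exponential_def by auto
  with mult [of a b 0 0] have one: "M (0, 0) = 1"
    by simp
  have first: "M (n, 0) = poly (chebyshev n) (M (Suc 0, 0))" for n
  proof (rule chebyshev_unique [of "\<lambda>n. M (n, 0)"])
    show "M (Suc (Suc n), 0) + M (n, 0) = 2 * M (Suc n, 0) * M (Suc 0, 0)" for n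
      using mult [of "Suc n" 0 "Suc 0" 0]
      by (simp add: nat_dist_eq_diff) algebra
  qed (fact one)
  have second: "M (0, n) = poly (chebyshev n) (M (0, Suc 0))" for n
  proof (rule chebyshev_unique [of "\<lambda>n. M (0, n)"])
    show "M (0, Suc (Suc n)) + M (0, n) = 2 * M (0, Suc n) * M (0, Suc 0)" for n
      using mult [of 0 "Suc n" 0 "Suc 0"]
      by (simp add: nat_dist_eq_diff) algebra
  qed (fact one)
  have "M (x, y) = M (x, 0) * M (0, y)"
    using mult [of x 0 0 y] by simp
  then show ?thesis
    by (simp only: first [of x] second [of y])
qed

theorem theorem2p1:
  shows "(\<forall>M :: nat \<times> nat \<Rightarrow> complex. exponential chebyshev_conv M \<longleftrightarrow>
            (\<exists>lam mu :: complex. \<forall>x y. M (x, y) = poly (chebyshev x) lam * poly (chebyshev y) mu))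
       \<and> bij_betw (\<lambda>(lam, mu). \<lambda>(x, y). poly (chebyshev x) lam * poly (chebyshev y) mu)
           (UNIV :: (complex \<times> complex) set)
           {M :: nat \<times> nat \<Rightarrow> complex. exponential chebyshev_conv M}"
proof (intro conjI allI iffI)
  fix M :: "nat \<times> nat \<Rightarrow> complex"
  assume "exponential chebyshev_conv M"
  then show "\<exists>lam mu. \<forall>x y. M (x, y) = poly (chebyshev x) lam * poly (chebyshev y) mu"
    by (blast intro: exponential_imp_chebyshev_product)
next
  fix M :: "nat \<times> nat \<Rightarrow> complex"
  assume "\<exists>lam mu. \<forall>x y. M (x, y) = poly (chebyshev x) lam * poly (chebyshev y) mu"
  then show "exponential chebyshev_conv M"
    by (blast intro: exponential_chebyshev_product)
next
  show "bij_betw (\<lambda>(lam, mu). \<lambda>(x, y). poly (chebyshev x) lam * poly (chebyshev y) mu)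
          (UNIV :: (complex \<times> complex) set)
          {M :: nat \<times> nat \<Rightarrow> complex. exponential chebyshev_conv M}"
    by (rule bij_betw_byWitness [where f' = "\<lambda>M. (M (Suc 0, 0), M (0, Suc 0))"])
       (auto simp: exponential_imp_chebyshev_product [symmetric]
             intro: exponential_chebyshev_product)
qed

end
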